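(* Let $f$ be the CRFBP vector field, let $\mathbf{x}_0\in\mathbb{R}^4$ be a saddle-focus equilibrium of $f$, and let $\Phi$ be the flow generated by $f$. Let $\Gamma^u,\Gamma^s\colon[-1,1]^2\to\mathbb{R}^4$ be smooth maps with components $\Gamma^{u}_j,\Gamma^s_j$ ($j=1,2,3,4$), taking values in the domain of $f$, with $\Gamma^u([-1,1]^2)\subset W^u(\mathbf{x}_0)$ and $\Gamma^s([-1,1]^2)\subset W^s(\mathbf{x}_0)$, and which are well aligned with the flow: there are $\tau_s,\tau_u>0$ with $\Phi(\Gamma^{s}(s,t_1),t_2/\tau_{s})=\Gamma^{s}(s,t_1+t_2)$ and $\Phi(\Gamma^{u}(s,t_1),t_2/\tau_{u})=\Gamma^{u}(s,t_1+t_2)$ for all $s,t_1\in[-1,1]$ and $t_2$ with $t_1+t_2\in[-1,1]$. Define $G\colon[-1,1]^3\to\mathbb{R}^3$ by $$G(s,t,\sigma)=\begin{pmatrix}\Gamma^u_1(s,t)-\Gamma^s_1(\sigma,0)\\ \Gamma^u_2(s,t)-\Gamma^s_2(\sigma,0)\\ \Gamma^u_3(s,t)-\Gamma^s_3(\sigma,0)\end{pmatrix}.$$ Suppose $(\hat s,\hat t,\hat\sigma)\in(-1,1)^3$ satisfies $G(\hat s,\hat t,\hat\sigma)=0$, and that $\Gamma^u_4(\hat s,\hat t)$ and $\Gamma^s_4(\hat\sigma,0)$ have the same sign, so that $\hat{\mathbf{x}}=\Gamma^u(\hat s,\hat t)=\Gamma^s(\hat\sigma,0)$ is a homoclinic point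 for $\mathbf{x}_0$. Assume that $DG(\hat s,\hat t,\hat\sigma)$ is nonsingular and that $\nabla E(\hat{\mathbf{x}})\neq0$. Then the energy level set $\mathcal{E}_0=\{\mathbf{x}: E(\mathbf{x})=E(\mathbf{x}_0)\}$ is a smooth $3$-manifold near $\hat{\mathbf{x}}$, and the stable and unstable manifolds of $\mathbf{x}_0$ intersect transversally at $\hat{\mathbf{x}}$ when restricted to the energy manifold, i.e. $T_{\hat{\mathbf{x}}}W^u(\mathbf{x}_0)+T_{\hat{\mathbf{x}}}W^s(\mathbf{x}_0)=T_{\hat{\mathbf{x}}}\mathcal{E}_0$.
   Context: Let $0<m_3\le m_2\le m_1<1$ with $m_1+m_2+m_3=1$, and put $K = m_2(m_3-m_2)+m_1(m_2+2m_3)$, $S=\sqrt{m_2^2+m_2m_3+m_3^2}$. The positions of the primaries are $x_1=-\frac{|K|}{K}S$, $y_1=0$; $x_2=\frac{|K|\,[(m_2-m_3)m_3+m_1(2m_2+m_3)]}{2KS}$, $y_2=-\frac{\sqrt3\,m_3}{2m_2^{3/2}}\sqrt{\frac{m_2^3}{S^2}}$; $x_3=\frac{|K|}{2S}$, $y_3=\frac{\sqrt3}{2\sqrt{m_2}}\sqrt{\frac{m_2^3}{S^2}}$. Let $r_j(x,y)=\sqrt{(x-x_j)^2+(y-y_j)^2}$ and $\Omega(x,y)=\frac12(x^2+y^2)+\sum_{j=1}^3\frac{m_j}{r_j(x,y)}$. The CRFBP vector field is $f(x,\dot x,y,\dot y)=(\dot x,\;2\dot y+\Omega_x(x,y),\;\dot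 y,\;-2\dot x+\Omega_y(x,y))$, defined on $\{(x,\dot x,y,\dot y)\in\mathbb{R}^4 : (x,y)\ne(x_j,y_j),\ j=1,2,3\}$. It conserves $E(x,\dot x,y,\dot y)=\frac12(\dot x^2+\dot y^2)-\Omega(x,y)$. $\mathbf{x}_0$ is a saddle-focus if the eigenvalues of $Df(\mathbf{x}_0)$ are $\pm\alpha\pm i\beta$ with $\alpha,\beta>0$; then $W^s(\mathbf{x}_0)$ and $W^u(\mathbf{x}_0)$ (points whose orbits converge to $\mathbf{x}_0$ as $t\to+\infty$, resp. $t\to-\infty$) are smooth two dimensional immersed manifolds. A point is homoclinic to $\mathbf{x}_0$ if it belongs to both. *)

theory Defs
  imports "HOL-Analysis.Analysis"
begin

section \<open>Smooth maps and submanifolds of Euclidean space\<close>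

primrec Ck_on ::
  "nat \<Rightarrow> 'a::euclidean_space set \<Rightarrow> ('a \<Rightarrow> 'b::euclidean_space) \<Rightarrow> bool" where
  "Ck_on 0 S f \<longleftrightarrow> continuous_on S f"
| "Ck_on (Suc k) S f \<longleftrightarrow>
     (\<exists>f'. (\<forall>x\<in>S. (f has_derivative f' x) (at x)) \<and> (\<forall>v. Ck_on k S (\<lambda>x. f' x v)))"

text \<open>On a set that need not be open (such as a closed square), smoothness means that
  there is a smooth extension to an open neighbourhood.\<close>

definition smooth_on :: "'a::euclidean_space set \<Rightarrow> ('a \<Rightarrow> 'b::euclidean_space) \<Rightarrow> bool" where
  "smooth_on S f \<longleftrightarrow>
     (\<exists>U g. open U \<and> S \<subseteq> U \<and> (\<forall>k. Ck_on k U g) \<and> (\<forall>x\<in>S. g x = f x))"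

text \<open>The first argument fixes the model space, and with it the dimension.\<close>

definition smooth_submanifold ::
  "'b::euclidean_space itself \<Rightarrow> 'a::euclidean_space set \<Rightarrow> bool" where
  "smooth_submanifold _ M \<longleftrightarrow>
     (\<forall>p\<in>M. \<exists>V (U :: 'b set) \<phi> \<psi>. open V \<and> p \<in> V \<and> open U \<and>
        homeomorphism U (M \<inter> V) \<phi> \<psi> \<and> smooth_on U \<phi> \<and> smooth_on (M \<inter> V) \<psi>)"

text \<open>An immersed submanifold is a subset \<open>topspace T\<close> with its own manifold topology
  \<open>T\<close>, in general finer than the subspace topology.  The charts need no separate
  compatibility condition: transition maps between immersed parametrizations that are
  homeomorphic onto \<open>T\<close>-open sets are automatically smooth.\<close>

definition immersed_submanifold ::
  "'b::euclidean_space itself \<Rightarrow> 'a::euclidean_space topology \<Rightarrow> bool" where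
  "immersed_submanifold _ T \<longleftrightarrow>
     continuous_map T euclidean id \<and> second_countable T \<and>
     (\<forall>p\<in>topspace T. \<exists>N (U :: 'b set) \<phi> \<psi>. openin T N \<and> p \<in> N \<and> open U \<and>
        homeomorphic_maps (top_of_set U) (subtopology T N) \<phi> \<psi> \<and> smooth_on U \<phi> \<and>
        (\<forall>u\<in>U. inj (frechet_derivative \<phi> (at u))))"

text \<open>Velocities at \<open>p\<close> of smooth curves in \<open>topspace T\<close>.  If \<open>T\<close> is the topology of an
  immersed submanifold, then a curve is smooth as a map into it iff it is smooth into the
  ambient space and continuous into \<open>T\<close>.  For the subspace topology the continuity
  condition is redundant, and the curves are all smooth curves lying in the set.\<close>

definition tangent_space :: "'a::euclidean_space topology \<Rightarrow> 'a \<Rightarrow> 'a set" where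
  "tangent_space T p =
     {v. \<exists>e>0. \<exists>c :: real \<Rightarrow> 'a. smooth_on {-e<..<e} c \<and>
           continuous_map (top_of_set {-e<..<e}) T c \<and>
           c 0 = p \<and> (c has_vector_derivative v) (at 0)}"

definition set_sum :: "'a::ab_group_add set \<Rightarrow> 'a set \<Rightarrow> 'a set" where
  "set_sum A B = {a + b | a b. a \<in> A \<and> b \<in> B}"

definition gradient :: "(real^'n \<Rightarrow> real) \<Rightarrow> real^'n \<Rightarrow> real^'n" where
  "gradient F p = (\<chi> i. frechet_derivative F (at p) (axis i 1))"

definition complex_eigenvalues :: "real^'n^'n \<Rightarrow> complex set" where
  "complex_eigenvalues A =
     {\<mu>. \<exists>v :: complex^'n. v \<noteq> 0 \<and> (\<chi> i j. complex_of_real (A $ i $ j)) *v v = \<mu> *s v}"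


section \<open>The circular restricted four body problem\<close>

text \<open>The masses are the components of \<open>m\<close>.\<close>

definition KK :: "real^3 \<Rightarrow> real" where
  "KK m = m$2 * (m$3 - m$2) + m$1 * (m$2 + 2 * m$3)"

definition SS :: "real^3 \<Rightarrow> real" where
  "SS m = sqrt ((m$2)^2 + m$2 * m$3 + (m$3)^2)"

definition prim_x :: "real^3 \<Rightarrow> real^3" where
  "prim_x m = vector
     [- (\<bar>KK m\<bar> / KK m) * SS m,
      \<bar>KK m\<bar> * ((m$2 - m$3) * m$3 + m$1 * (2 * m$2 + m$3)) / (2 * KK m * SS m),
      \<bar>KK m\<bar> / (2 * SS m)]"

definition prim_y :: "real^3 \<Rightarrow> real^3" where
  "prim_y m = vector
     [0,
      - (sqrt 3 * m$3) / (2 * m$2 powr (3/2)) * sqrt ((m$2)^3 / (SS m)^2),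
      sqrt 3 / (2 * sqrt (m$2)) * sqrt ((m$2)^3 / (SS m)^2)]"

definition dist_prim :: "real^3 \<Rightarrow> 3 \<Rightarrow> real \<Rightarrow> real \<Rightarrow> real" where
  "dist_prim m j x y = sqrt ((x - prim_x m $ j)^2 + (y - prim_y m $ j)^2)"

definition Omega :: "real^3 \<Rightarrow> real \<Rightarrow> real \<Rightarrow> real" where
  "Omega m x y = 1/2 * (x^2 + y^2) + (\<Sum>j\<in>UNIV. m$j / dist_prim m j x y)"

text \<open>Phase space coordinates are ordered as \<open>(x, x', y, y')\<close>, a prime denoting velocity.\<close>

definition phase_domain :: "real^3 \<Rightarrow> (real^4) set" where
  "phase_domain m = {v. \<forall>j. (v$1, v$3) \<noteq> (prim_x m $ j, prim_y m $ j)}"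

definition crfbp :: "real^3 \<Rightarrow> real^4 \<Rightarrow> real^4" where
  "crfbp m v = vector
     [v$2,
      2 * v$4 + deriv (\<lambda>x. Omega m x (v$3)) (v$1),
      v$4,
      - 2 * v$2 + deriv (\<lambda>y. Omega m (v$1) y) (v$3)]"

definition energy :: "real^3 \<Rightarrow> real^4 \<Rightarrow> real" where
  "energy m v = 1/2 * ((v$2)^2 + (v$4)^2) - Omega m (v$1) (v$3)"

definition energy_level :: "real^3 \<Rightarrow> real^4 \<Rightarrow> (real^4) set" where
  "energy_level m x0 = {v \<in> phase_domain m. energy m v = energy m x0}"

definition saddle_focus :: "real^3 \<Rightarrow> real^4 \<Rightarrow> bool" where
  "saddle_focus m x0 \<longleftrightarrow>
     x0 \<in> phase_domain m \<and> crfbp m x0 = 0 \<and>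
     (\<exists>\<alpha>>0. \<exists>\<beta>>0. complex_eigenvalues (jacobian (crfbp m) (at x0)) =
        {Complex \<alpha> \<beta>, Complex \<alpha> (-\<beta>), Complex (-\<alpha>) \<beta>, Complex (-\<alpha>) (-\<beta>)})"

definition integral_curve :: "real^3 \<Rightarrow> (real \<Rightarrow> real^4) \<Rightarrow> real set \<Rightarrow> bool" where
  "integral_curve m c I \<longleftrightarrow>
     (\<forall>t\<in>I. c t \<in> phase_domain m \<and> (c has_vector_derivative crfbp m (c t)) (at t within I))"

text \<open>The vector field is not complete (there are collisions), so the flow is a local
  flow: it is only meaningful on its domain.  The point chosen in the definition of the flow
  is unique there, by uniqueness of solutions of initial value problems.\<close>

definition flow_domain :: "real^3 \<Rightarrow> ((real^4) \<times> real) set" where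
  "flow_domain m = {(p, t). \<exists>c. integral_curve m c (closed_segment 0 t) \<and> c 0 = p}"

definition flow :: "real^3 \<Rightarrow> real^4 \<Rightarrow> real \<Rightarrow> real^4" where
  "flow m p t = (SOME q. \<exists>c. integral_curve m c (closed_segment 0 t) \<and> c 0 = p \<and> c t = q)"

definition stable_manifold :: "real^3 \<Rightarrow> real^4 \<Rightarrow> (real^4) set" where
  "stable_manifold m x0 =
     {p. (\<forall>t\<ge>0. (p, t) \<in> flow_domain m) \<and> (flow m p \<longlongrightarrow> x0) at_top}"

definition unstable_manifold :: "real^3 \<Rightarrow> real^4 \<Rightarrow> (real^4) set" where
  "unstable_manifold m x0 =
     {p. (\<forall>t\<le>0. (p, t) \<in> flow_domain m) \<and> (flow m p \<longlongrightarrow> x0) at_bot}"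

definition homoclinic :: "real^3 \<Rightarrow> real^4 \<Rightarrow> real^4 \<Rightarrow> bool" where
  "homoclinic m x0 p \<longleftrightarrow> p \<in> stable_manifold m x0 \<and> p \<in> unstable_manifold m x0"

abbreviation unit_square :: "(real \<times> real) set" where
  "unit_square \<equiv> {-1..1} \<times> {-1..1}"

definition well_aligned :: "real^3 \<Rightarrow> (real \<times> real \<Rightarrow> real^4) \<Rightarrow> bool" where
  "well_aligned m \<Gamma> \<longleftrightarrow>
     (\<exists>\<tau>>0. \<forall>s\<in>{-1..1}. \<forall>t1\<in>{-1..1}. \<forall>t2. t1 + t2 \<in> {-1..1} \<longrightarrow>
        (\<Gamma> (s, t1), t2 / \<tau>) \<in> flow_domain m \<and>
        flow m (\<Gamma> (s, t1)) (t2 / \<tau>) = \<Gamma> (s, t1 + t2))"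

text \<open>The map \<open>G\<close>, whose argument has components \<open>(s, t, \<sigma>)\<close>.  It is only used on the cube
  with sides \<open>[-1,1]\<close>.\<close>

definition G_map ::
  "(real \<times> real \<Rightarrow> real^4) \<Rightarrow> (real \<times> real \<Rightarrow> real^4) \<Rightarrow> real^3 \<Rightarrow> real^3" where
  "G_map \<Gamma>u \<Gamma>s w = vector
     [\<Gamma>u (w$1, w$2) $ 1 - \<Gamma>s (w$3, 0) $ 1,
      \<Gamma>u (w$1, w$2) $ 2 - \<Gamma>s (w$3, 0) $ 2,
      \<Gamma>u (w$1, w$2) $ 3 - \<Gamma>s (w$3, 0) $ 3]"

text \<open>The library characterizes \<open>vector\<close> only up to dimension 3.\<close>

lemma vector_4 [simp]:
  "(vector [a, b, c, d] :: 'a::zero^4) $ 1 = a"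
  "(vector [a, b, c, d] :: 'a::zero^4) $ 2 = b"
  "(vector [a, b, c, d] :: 'a::zero^4) $ 3 = c"
  "(vector [a, b, c, d] :: 'a::zero^4) $ 4 = d"
  unfolding vector_def by simp_all

end

theory Submission
  imports Defs
begin

text \<open>The energy is conserved along orbits and continuous at the equilibrium, so both invariant
  manifolds lie in the energy level, and all of their tangent vectors at the homoclinic point lie
  in the kernel of the derivative of the energy.  This kernel has dimension \<open>3\<close>, and it is the tangent space
  of the level because the energy can be straightened there by the inverse function theorem.
  Conversely, if \<open>DG\<close> is nonsingular, then the two partial derivatives of \<open>\<Gamma>u\<close> and
  the partial derivative of \<open>\<Gamma>s\<close> along its first variable are independent already after projection to the
  first three coordinates; they span a \<open>3\<close>-dimensional subspace of the kernel, which is therefore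
  the whole kernel.\<close>

section \<open>Calculus of differentiable maps\<close>

lemma Ck_on_Suc_imp: "Ck_on (Suc k) S f \<Longrightarrow> Ck_on k S f"
proof (induction k arbitrary: f)
  case 0
  then show ?case
    by (auto intro!: continuous_at_imp_continuous_on dest: has_derivative_continuous)
next
  case (Suc k)
  then show ?case unfolding Ck_on.simps(2)[of "Suc k"] Ck_on.simps(2)[of k S f] by blast
qed

lemma Ck_on_const: "Ck_on k S (\<lambda>x. c)"
  by (induction k arbitrary: c) (auto intro!: exI[of _ "\<lambda>x v. 0"])

lemma Ck_on_bounded_linear:
  assumes "bounded_linear L"
  shows "Ck_on k S L"
proof (cases k)
  case 0
  then show ?thesis using assms by (simp add: linear_continuous_on)
next
  case (Suc n)
  then show ?thesis
    using assms by (auto intro!: exI[of _ "\<lambda>x. L"] bounded_linear_imp_has_derivative Ck_on_const)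
qed

lemma Ck_on_add: "Ck_on k S f \<Longrightarrow> Ck_on k S g \<Longrightarrow> Ck_on k S (\<lambda>x. f x + g x)"
proof (induction k arbitrary: f g)
  case (Suc k)
  then obtain f' g' where "\<forall>x\<in>S. (f has_derivative f' x) (at x)" "\<forall>v. Ck_on k S (\<lambda>x. f' x v)"
    "\<forall>x\<in>S. (g has_derivative g' x) (at x)" "\<forall>v. Ck_on k S (\<lambda>x. g' x v)" by auto
  then show ?case
    by (auto intro!: exI[of _ "\<lambda>x v. f' x v + g' x v"] has_derivative_add Suc.IH)
qed (auto intro: continuous_on_add)

lemma Ck_on_scaleR:
  "Ck_on k S f \<Longrightarrow> Ck_on k S g \<Longrightarrow> Ck_on k S (\<lambda>x. f x *\<^sub>R g x)"
proof (induction k arbitrary: f g)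
  case (Suc k)
  then obtain f' g' where "\<forall>x\<in>S. (f has_derivative f' x) (at x)" "\<forall>v. Ck_on k S (\<lambda>x. f' x v)"
    "\<forall>x\<in>S. (g has_derivative g' x) (at x)" "\<forall>v. Ck_on k S (\<lambda>x. g' x v)" by auto
  \<comment> \<open>The product rule leaves one factor undifferentiated in each term, so
    \<open>f\<close> and \<open>g\<close> enter the derivative themselves, at order
    \<open>k\<close>.\<close>
  moreover have "Ck_on k S f" "Ck_on k S g"
    using Suc.prems Ck_on_Suc_imp by blast+
  ultimately show ?case
    unfolding Ck_on.simps
    by (intro exI[of _ "\<lambda>x v. f x *\<^sub>R g' x v + f' x v *\<^sub>R g x"])
      (simp add: has_derivative_scaleR Ck_on_add Suc.IH)
qed (auto intro: continuous_on_scaleR)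

lemma Ck_on_sum: "(\<And>i. i \<in> I \<Longrightarrow> Ck_on k S (f i)) \<Longrightarrow> Ck_on k S (\<lambda>x. \<Sum>i\<in>I. f i x)"
  by (induction I rule: infinite_finite_induct) (auto intro: Ck_on_const Ck_on_add)

lemma Ck_on_compose_bounded_linear:
  assumes "bounded_linear L"
  shows "Ck_on k S f \<Longrightarrow> Ck_on k S (\<lambda>x. L (f x))"
proof (induction k arbitrary: f)
  case 0
  then show ?case using assms by (simp add: bounded_linear.continuous_on)
next
  case (Suc k)
  then obtain f' where "\<forall>x\<in>S. (f has_derivative f' x) (at x)" "\<forall>v. Ck_on k S (\<lambda>x. f' x v)"
    by auto
  then show ?case
    by (auto intro!: exI[of _ "\<lambda>x v. L (f' x v)"] bounded_linear.has_derivative[OF assms] Suc.IH)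
qed

lemma Ck_on_inner_left: "Ck_on k S f \<Longrightarrow> Ck_on k S (\<lambda>x. f x \<bullet> b)"
  by (rule Ck_on_compose_bounded_linear[OF bounded_linear_inner_left])

lemma Ck_on_minus: "Ck_on k S f \<Longrightarrow> Ck_on k S (\<lambda>x. - f x)"
  by (rule Ck_on_compose_bounded_linear[OF bounded_linear_minus[OF bounded_linear_ident]])

lemma Ck_on_diff: "Ck_on k S f \<Longrightarrow> Ck_on k S g \<Longrightarrow> Ck_on k S (\<lambda>x. f x - g x)"
  using Ck_on_add[OF _ Ck_on_minus] by force

lemma Ck_on_mult:
  fixes f g :: "'a::euclidean_space \<Rightarrow> real"
  shows "Ck_on k S f \<Longrightarrow> Ck_on k S g \<Longrightarrow> Ck_on k S (\<lambda>x. f x * g x)"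
  using Ck_on_scaleR[of k S f g] by simp

lemma Ck_on_compose:
  "Ck_on k T g \<Longrightarrow> Ck_on k S f \<Longrightarrow> f ` S \<subseteq> T \<Longrightarrow> Ck_on k S (\<lambda>x. g (f x))"
proof (induction k arbitrary: g)
  case 0
  then show ?case using continuous_on_compose2 by fastforce
next
  case (Suc k)
  obtain f' g' where f': "\<And>x. x \<in> S \<Longrightarrow> (f has_derivative f' x) (at x)" "\<And>v. Ck_on k S (\<lambda>x. f' x v)"
    and g': "\<And>x. x \<in> T \<Longrightarrow> (g has_derivative g' x) (at x)" "\<And>v. Ck_on k T (\<lambda>x. g' x v)"
    using Suc.prems(1,2) unfolding Ck_on.simps by blast
  \<comment> \<open>The chain rule gives \<open>g' (f x) (f' x v)\<close>, whose direction moves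
    with \<open>x\<close>, while \<open>Ck_on\<close> controls \<open>g'\<close> only in fixed
    directions. Expanding \<open>f' x v\<close> in the basis leaves a finite sum of products of maps
    already known to be of class \<open>k\<close>.\<close>
  define h' where "h' x v = (\<Sum>b\<in>Basis. (f' x v \<bullet> b) *\<^sub>R g' (f x) b)" for x v
  have "((\<lambda>x. g (f x)) has_derivative h' x) (at x)" if "x \<in> S" for x
  proof -
    have fx: "f x \<in> T" using that Suc.prems by auto
    have lin: "linear (g' (f x))" using g'(1)[OF fx] has_derivative_linear by blast
    have "h' x v = g' (f x) (f' x v)" for v
      unfolding h'_def using lin
      by (subst (2) euclidean_representation[symmetric, of "f' x v"])
        (simp add: linear_sum linear_cmul)
    then show ?thesis
      using has_derivative_compose[OF f'(1)[OF that] g'(1)[OF fx]] by presburger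
  qed
  moreover have "Ck_on k S (\<lambda>x. h' x v)" for v
    unfolding h'_def
    by (intro Ck_on_sum Ck_on_scaleR Ck_on_inner_left f' Suc.IH[OF g'(2)] Suc.prems(3)
        Ck_on_Suc_imp[OF Suc.prems(2)])
  ultimately show ?case by auto
qed

text \<open>Derivatives are taken in the full space, so on an open set agreement with
  \<open>f\<close> lets the derivative of \<open>f\<close> serve for \<open>g\<close> at once, at
  every order.\<close>

lemma Ck_on_cong:
  assumes S: "open S" and f: "Ck_on k S f" and eq: "\<And>x. x \<in> S \<Longrightarrow> f x = g x"
  shows "Ck_on k S g"
proof (cases k)
  case 0
  with f eq show ?thesis using continuous_on_cong[of S S f g] by simp
next
  case (Suc n)
  with f obtain f' where "\<And>x. x \<in> S \<Longrightarrow> (f has_derivative f' x) (at x)" "\<And>v. Ck_on n S (\<lambda>x. f' x v)"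
    by auto
  with Suc eq show ?thesis
    using has_derivative_transform_within_open[OF _ S, of f _ _ UNIV g]
    by (auto intro!: exI[of _ f'])
qed

lemma Ck_on_subset: "Ck_on k S f \<Longrightarrow> T \<subseteq> S \<Longrightarrow> Ck_on k T f"
proof (induction k arbitrary: f)
  case 0
  then show ?case using continuous_on_subset by auto
next
  case (Suc k)
  then show ?case unfolding Ck_on.simps by (meson subsetD)
qed

text \<open>The derivative in \<open>Ck_on\<close> is an existential witness that could vary with
  \<open>k\<close>. Uniqueness of derivatives makes \<open>frechet_derivative\<close> a witness
  common to all orders.\<close>

lemma Ck_on_Suc_frechet:
  assumes "open S"
  shows "Ck_on (Suc k) S f \<longleftrightarrow> (\<forall>x\<in>S. f differentiable at x) \<and>
    (\<forall>v. Ck_on k S (\<lambda>x. frechet_derivative f (at x) v))" (is "?l \<longleftrightarrow> ?r")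
proof
  assume ?l
  then obtain f' where f': "\<And>x. x \<in> S \<Longrightarrow> (f has_derivative f' x) (at x)" "\<And>v. Ck_on k S (\<lambda>x. f' x v)"
    by auto
  then have eq: "f' x v = frechet_derivative f (at x) v" if "x \<in> S" for x v
    using frechet_derivative_at[OF f'(1)[OF that]] by simp
  have "\<forall>x\<in>S. f differentiable at x"
    using f'(1) by (blast intro: differentiableI)
  moreover have "Ck_on k S (\<lambda>x. frechet_derivative f (at x) v)" for v
    using f'(2) by (rule Ck_on_cong[OF assms]) (rule eq)
  ultimately show ?r by blast
next
  assume r: ?r
  show ?l
    unfolding Ck_on.simps
    by (rule exI[of _ "\<lambda>x. frechet_derivative f (at x)"])
      (use r in \<open>blast intro: frechet_derivative_works[THEN iffD1]\<close>)
qed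

section \<open>Real powers and reciprocals\<close>

lemma Ck_on_powr: "Ck_on k {0<..} (\<lambda>x::real. x powr a)"
\<comment> \<open>The exponent varies because differentiation passes from \<open>a\<close> to
  \<open>a - 1\<close>.\<close>
proof (induction k arbitrary: a)
  case 0
  then show ?case by (auto intro!: continuous_intros)
next
  case (Suc k)
  have "((\<lambda>x. x powr a) has_derivative (\<lambda>v. (a * x powr (a - 1)) * v)) (at x)" if "x > 0" for x :: real
    using has_real_derivative_powr[OF that, of a] by (simp add: has_field_derivative_def)
  then show ?case
    by (auto intro!: exI[of _ "\<lambda>x v. (a * x powr (a - 1)) * v"] Ck_on_mult Ck_on_const Suc.IH)
qed

lemma Ck_on_inverse:
  fixes f :: "'a::euclidean_space \<Rightarrow> real"
  assumes f: "Ck_on k S f" and nz: "\<And>x. x \<in> S \<Longrightarrow> f x \<noteq> 0"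
  shows "Ck_on k S (\<lambda>x. inverse (f x))"
proof -
  \<comment> \<open>The derivative of the reciprocal is a polynomial in the reciprocal itself, so
    the induction closes.\<close>
  have "Ck_on k (- {0}) (inverse :: real \<Rightarrow> real)"
  proof (induction k)
    case 0
    then show ?case by (auto intro!: continuous_intros)
  next
    case (Suc k)
    show ?case
      unfolding Ck_on.simps
    proof (intro exI[of _ "\<lambda>x v. - (inverse x * v * inverse x)"] conjI ballI allI)
      show "(inverse has_derivative (\<lambda>v. - (inverse x * v * inverse x))) (at x)"
        if "x \<in> - {0}" for x :: real
        using that by (auto intro: has_derivative_inverse')
      show "Ck_on k (- {0}) (\<lambda>x. - (inverse x * v * inverse x))" for v :: real
        by (intro Ck_on_minus Ck_on_mult Ck_on_const Suc.IH)
    qed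
  qed
  from Ck_on_compose[OF this f] nz show ?thesis by force
qed

section \<open>Tangent spaces\<close>

lemma smooth_on_imp_continuous_on: "smooth_on S f \<Longrightarrow> continuous_on S f"
  unfolding smooth_on_def by (metis Ck_on.simps(1) continuous_on_cong continuous_on_subset)

text \<open>The smooth extension agrees with \<open>f\<close> only on \<open>S\<close>, so its
  derivative passes to \<open>f\<close> at interior points.\<close>

lemma smooth_on_imp_differentiable:
  assumes "smooth_on S f" "q \<in> interior S"
  shows "f differentiable at q"
proof -
  obtain U g where U: "open U" "S \<subseteq> U" "\<forall>k. Ck_on k U g" "\<forall>x\<in>S. g x = f x"
    using assms unfolding smooth_on_def by blast
  have "q \<in> U" using assms U interior_subset by blast
  then obtain g' where "(g has_derivative g') (at q)"
    using U(3)[rule_format, of "Suc 0"] by auto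
  then have "(f has_derivative g') (at q)"
    using has_derivative_transform_within_open[OF _ open_interior assms(2)] U(4) interior_subset
    by (metis subsetD)
  then show ?thesis by (rule differentiableI)
qed

section \<open>Curves that realize tangent vectors\<close>

lemma smooth_on_affine_line:
  fixes \<gamma> :: "'a::euclidean_space \<Rightarrow> 'b::euclidean_space"
  assumes "smooth_on S \<gamma>" "\<And>r. r \<in> J \<Longrightarrow> q + r *\<^sub>R u \<in> S"
  shows "smooth_on J (\<lambda>r. \<gamma> (q + r *\<^sub>R u))"
proof -
  obtain U g where U: "open U" "S \<subseteq> U" "\<forall>k. Ck_on k U g" "\<forall>x\<in>S. g x = \<gamma> x"
    using assms(1) unfolding smooth_on_def by blast
  let ?l = "\<lambda>r::real. q + r *\<^sub>R u"
  have "open (?l -` U)"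
    using U(1) by (intro open_vimage continuous_intros)
  moreover have "Ck_on k (?l -` U) (\<lambda>r. g (?l r))" for k
    by (rule Ck_on_compose[OF U(3)[rule_format]])
      (intro Ck_on_add Ck_on_const Ck_on_bounded_linear bounded_linear_scaleR_left, auto)
  ultimately show ?thesis
    unfolding smooth_on_def using U(4) assms(2) subsetD[OF U(2) assms(2)]
    by (intro exI[of _ "?l -` U"] exI[of _ "\<lambda>r. g (?l r)"] conjI allI) auto
qed

lemma line_in_open:
  fixes q :: "'a::real_normed_vector"
  assumes "open V" "q \<in> V"
  obtains e where "e > 0" "\<And>r. r \<in> {-e<..<e} \<Longrightarrow> q + r *\<^sub>R u \<in> V"
proof -
  have "open ((\<lambda>r::real. q + r *\<^sub>R u) -` V)" "0 \<in> (\<lambda>r::real. q + r *\<^sub>R u) -` V"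
    using assms by (auto intro!: open_vimage continuous_intros)
  then obtain e where "e > 0" "ball 0 e \<subseteq> (\<lambda>r::real. q + r *\<^sub>R u) -` V"
    using open_contains_ball by blast
  then show ?thesis by (intro that[of e]) (auto simp: subset_iff)
qed

text \<open>The image of a short segment through \<open>q\<close> in direction \<open>u\<close> is a
  curve with the required velocity. Continuity into \<open>T\<close> is a separate assumption
  because the topology of an immersed manifold can be finer than the ambient one.\<close>

lemma frechet_derivative_in_tangent_space:
  fixes \<gamma> :: "'a::euclidean_space \<Rightarrow> 'b::euclidean_space"
  assumes sm: "smooth_on S \<gamma>" and q: "q \<in> interior S"
    and cont: "continuous_map (top_of_set S) T \<gamma>"
  shows "frechet_derivative \<gamma> (at q) u \<in> tangent_space T (\<gamma> q)"
proof -
  obtain e where e: "e > 0" and "\<And>r. r \<in> {-e<..<e} \<Longrightarrow> q + r *\<^sub>R u \<in> interior S"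
    using line_in_open[OF open_interior q] by metis
  then have inS: "\<And>r. r \<in> {-e<..<e} \<Longrightarrow> q + r *\<^sub>R u \<in> S"
    using interior_subset by blast
  let ?c = "\<lambda>r. \<gamma> (q + r *\<^sub>R u)"
  have "continuous_map (top_of_set {-e<..<e}) (top_of_set S) (\<lambda>r. q + r *\<^sub>R u)"
    using inS by (auto intro!: continuous_intros)
  from continuous_map_compose[OF this cont] have "continuous_map (top_of_set {-e<..<e}) T ?c"
    by (simp add: o_def)
  moreover have "(?c has_vector_derivative frechet_derivative \<gamma> (at q) u) (at 0)"
  proof -
    have "(\<gamma> has_derivative frechet_derivative \<gamma> (at q)) (at q)"
      using smooth_on_imp_differentiable[OF sm q] frechet_derivative_works by blast
    then have "((\<lambda>r. \<gamma> (q + r *\<^sub>R u)) has_derivative (\<lambda>r. frechet_derivative \<gamma> (at q) (r *\<^sub>R u))) (at 0)"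
      by (intro has_derivative_compose[of "\<lambda>r. q + r *\<^sub>R u" _ 0 UNIV \<gamma>])
        (auto intro!: derivative_eq_intros)
    moreover have "linear (frechet_derivative \<gamma> (at q))"
      using smooth_on_imp_differentiable[OF sm q] linear_frechet_derivative by blast
    ultimately show ?thesis
      by (simp add: has_vector_derivative_def linear_cmul)
  qed
  moreover have "smooth_on {-e<..<e} ?c"
    using sm inS by (rule smooth_on_affine_line)
  ultimately show ?thesis
    unfolding tangent_space_def using e
    by (intro CollectI exI[of _ e] conjI exI[of _ ?c]) auto
qed

text \<open>Along a curve in \<open>T\<close> the function \<open>E\<close> is constant, while the
  chain rule gives its derivative at 0 as \<open>E' w\<close>.\<close>

lemma tangent_space_subset_kernel:
  assumes E: "(E has_derivative E') (at p)" and const: "\<And>v. v \<in> topspace T \<Longrightarrow> E v = (k :: real)"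
  shows "tangent_space T p \<subseteq> {w. E' w = 0}"
proof safe
  fix w assume "w \<in> tangent_space T p"
  then obtain e c where e: "e > 0" and cont: "continuous_map (top_of_set {-e<..<e}) T c"
    and c: "c 0 = p" "(c has_vector_derivative w) (at (0::real))"
    unfolding tangent_space_def by blast
  have "((\<lambda>r. E (c r)) has_derivative (\<lambda>r. E' (r *\<^sub>R w))) (at 0)"
    using has_derivative_compose[of c "\<lambda>r. r *\<^sub>R w" 0 UNIV E E'] c E
    by (simp add: has_vector_derivative_def)
  moreover have "((\<lambda>r. E (c r)) has_derivative (\<lambda>r. 0)) (at 0)"
  proof (rule has_derivative_transform_within_open[of "\<lambda>r. k" _ 0 UNIV "{-e<..<e}"])
    show "k = E (c r)" if "r \<in> {-e<..<e}" for r
      using const[of "c r"] image_subset_iff[THEN iffD1, OF continuous_map_image_subset_topspace[OF cont]] that by simp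
  qed (use e in auto)
  ultimately have "(\<lambda>r. E' (r *\<^sub>R w)) = (\<lambda>r. 0)"
    by (rule has_derivative_unique)
  then show "E' w = 0" by (metis scaleR_one)
qed

lemma smooth_on_open: "open S \<Longrightarrow> \<forall>k. Ck_on k S f \<Longrightarrow> smooth_on S f"
  unfolding smooth_on_def by blast

lemma smooth_on_subset: "smooth_on S f \<Longrightarrow> T \<subseteq> S \<Longrightarrow> smooth_on T f"
  unfolding smooth_on_def by blast

text \<open>A dimension count: the range of \<open>L\<close> lies in the sum, the sum lies in the
  kernel of \<open>E'\<close>, and the two outer sets are subspaces of equal dimension. This way
  \<open>A\<close> and \<open>B\<close> can be arbitrary sets of vectors.\<close>

lemma set_sum_eq_kernel:
  fixes E' :: "'a::euclidean_space \<Rightarrow> real" and L :: "'c::euclidean_space \<Rightarrow> 'a"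
  assumes E': "linear E'" "E' n \<noteq> 0" and L: "linear L" "inj L" and dim: "DIM('a) = Suc DIM('c)"
    and AB: "A \<subseteq> {w. E' w = 0}" "B \<subseteq> {w. E' w = 0}" and rng: "range L \<subseteq> set_sum A B"
  shows "set_sum A B = {w. E' w = 0}"
proof -
  \<comment> \<open>The vector representing \<open>E'\<close> through the inner product, so that the
    kernel becomes a hyperplane of known dimension.\<close>
  let ?a = "adjoint E' 1"
  have E'_eq: "E' w = ?a \<bullet> w" for w
    using adjoint_works[OF E'(1), of w 1] by (simp add: inner_commute)
  have sub: "set_sum A B \<subseteq> {w. E' w = 0}"
    using AB linear_add[OF E'(1)] by (force simp: set_sum_def)
  have "?a \<noteq> 0" using E'(2) E'_eq by force
  then have "dim {w. E' w = 0} = DIM('c)"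
    using dim by (simp add: E'_eq dim_hyperplane)
  moreover have "dim (range L) = DIM('c)"
    using dim_image_eq[OF L(1), of UNIV] L(2) by (simp add: dim_UNIV)
  moreover have "subspace (range L)" "subspace {w. E' w = 0}"
    using linear_subspace_image[OF L(1) subspace_UNIV] linear_subspace_kernel[OF E'(1)] by auto
  ultimately have "range L = {w. E' w = 0}"
    using rng sub by (intro subspace_dim_equal) auto
  with rng sub show ?thesis by blast
qed

section \<open>Regular level sets\<close>

text \<open>With \<open>n\<close> a unit vector transversal to the level set, the straightening map is
  \<open>v \<mapsto> v + (E v - E p - n \<bullet> v) n\<close>, which exchanges the coordinate along \<open>n\<close> for the value of \<open>E\<close>.\<close>

lemma regular_level_straightening:
  fixes E :: "'a::euclidean_space \<Rightarrow> real"
  assumes D: "open D" "p \<in> D" and E: "\<And>k. Ck_on k D E"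
    and n: "norm n = 1" "frechet_derivative E (at p) n \<noteq> 0"
  obtains U V F g where "open U" "p \<in> U" "U \<subseteq> D" "open V" "homeomorphism U V F g"
    "\<And>k. Ck_on k U F" "\<And>k. Ck_on k V g" "\<And>v. v \<in> U \<Longrightarrow> n \<bullet> F v = E v - E p"
proof -
  define E' where "E' v = frechet_derivative E (at v)" for v
  define F where "F v = v + (E v - E p - n \<bullet> v) *\<^sub>R n" for v
  define F' where "F' v h = h + (E' v h - n \<bullet> h) *\<^sub>R n" for v h
  \<comment> \<open>The inverse of \<open>F' v\<close>: if \<open>F' v h = k\<close>, pairing with
    \<open>n\<close> gives \<open>E' v h = n \<bullet> k\<close>, and \<open>h\<close> differs from
    \<open>k\<close> by a multiple of \<open>n\<close>, which applying \<open>E' v\<close>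
    determines.\<close>
  define G' where "G' v k = k + ((n \<bullet> k - E' v k) * inverse (E' v n)) *\<^sub>R n" for v k
  define D' where "D' = {v \<in> D. E' v n \<noteq> 0}"
  have nn: "n \<bullet> n = 1" using n by (simp add: dot_square_norm)
  have CE': "Ck_on k D (\<lambda>v. E' v w)" for k w
    using E[of "Suc k"] unfolding Ck_on_Suc_frechet[OF D(1)] E'_def by blast
  have dE: "(E has_derivative E' v) (at v)" if "v \<in> D" for v
    using E[of "Suc 0"] that unfolding Ck_on_Suc_frechet[OF D(1)] E'_def frechet_derivative_works by blast
  have lin: "linear (E' v)" if "v \<in> D" for v
    using dE[OF that] by (rule has_derivative_linear)
  have "open (D \<inter> (\<lambda>v. E' v n) -` (- {0}))"
    using CE'[of 0 n] D by (intro continuous_open_preimage) auto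
  moreover have "D' = D \<inter> (\<lambda>v. E' v n) -` (- {0})" by (auto simp: D'_def)
  ultimately have "open D'" by simp
  have "p \<in> D'" "D' \<subseteq> D" using D n by (auto simp: D'_def E'_def)
  have dF: "(F has_derivative F' v) (at v)" if "v \<in> D" for v
    unfolding F_def F'_def by (rule derivative_eq_intros dE[OF that] refl)+ simp
  have bl: "bounded_linear (F' v)" if "v \<in> D" for v
    using dF[OF that] has_derivative_bounded_linear by blast
  \<comment> \<open>The inverse function theorem takes the derivative as a continuous map into
    bounded linear operators; in finite dimension, continuity can be checked on basis
    vectors.\<close>
  define f' where "f' v = Blinfun (F' v)" for v
  have f': "blinfun_apply (f' v) = F' v" if "v \<in> D" for v
    unfolding f'_def using bl[OF that] by (rule bounded_linear_Blinfun_apply)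
  have FG: "F' v (G' v k) = k" and GF: "G' v (F' v h) = h" if "v \<in> D'" for v h k
  proof -
    have "linear (E' v)" "E' v n \<noteq> 0" using that lin by (auto simp: D'_def)
    then have E'_eq: "E' v (x + r *\<^sub>R n) = E' v x + r * E' v n" for x r
      by (simp add: linear_add linear_cmul)
    show "F' v (G' v k) = k"
      unfolding F'_def G'_def E'_eq using \<open>E' v n \<noteq> 0\<close> nn
      by (simp add: inner_add_right field_simps flip: scaleR_add_left scaleR_diff_left)
    have "n \<bullet> F' v h = E' v h" "E' v (F' v h) = E' v h + (E' v h - n \<bullet> h) * E' v n"
      unfolding F'_def E'_eq by (simp_all add: inner_add_right nn)
    then have "(n \<bullet> F' v h - E' v (F' v h)) * inverse (E' v n) = - (E' v h - n \<bullet> h)"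
      using \<open>E' v n \<noteq> 0\<close> by (simp add: mult.assoc)
    then show "G' v (F' v h) = h"
      unfolding G'_def by (simp add: F'_def flip: scaleR_add_left scaleR_diff_left)
  qed
  have blG: "bounded_linear (G' p)"
    unfolding G'_def using dE[OF D(2)] 
    by (intro bounded_linear_intros) (auto dest: has_derivative_bounded_linear)
  have "Blinfun (G' p) o\<^sub>L f' p = id_blinfun"
    by (rule blinfun_eqI) (simp add: bounded_linear_Blinfun_apply[OF blG] f' D GF \<open>p \<in> D'\<close>)
  moreover have "continuous_on D' f'"
  proof (rule continuous_on_blinfun_componentwise)
    fix i :: 'a
    have "continuous_on D' (\<lambda>v. F' v i)"
      unfolding F'_def using continuous_on_subset[OF CE'[of 0 i, simplified] \<open>D' \<subseteq> D\<close>]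
      by (intro continuous_intros)
    then show "continuous_on D' (\<lambda>v. f' v i)"
      by (rule continuous_on_eq) (use f' \<open>D' \<subseteq> D\<close> in auto)
  qed
  moreover have "(F has_derivative blinfun_apply (f' v)) (at v)" if "v \<in> D'" for v
    using dF f' that \<open>D' \<subseteq> D\<close> by auto
  ultimately obtain U V g g' where UV: "open U" "U \<subseteq> D'" "p \<in> U" "open V" "homeomorphism U V F g"
    and g': "\<And>y. y \<in> V \<Longrightarrow> (g has_derivative g' y) (at y)"
      "\<And>y. y \<in> V \<Longrightarrow> g' y = inv (blinfun_apply (f' (g y)))"
    using inverse_function_theorem[OF \<open>open D'\<close> _ _ \<open>p \<in> D'\<close>, of F f' "Blinfun (G' p)"] by metis
  have gD: "g ` V \<subseteq> D'" using UV by (auto simp: homeomorphism_def)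
  have dg: "(g has_derivative G' (g y)) (at y)" if "y \<in> V" for y
  proof -
    have gy: "g y \<in> D'" using gD that by blast
    have "inv (F' (g y)) = G' (g y)"
      using FG[OF gy] GF[OF gy] by (intro inv_equality) auto
    moreover have "blinfun_apply (f' (g y)) = F' (g y)" using f' gy \<open>D' \<subseteq> D\<close> by blast
    ultimately show ?thesis using g'[OF that] by simp
  qed
  \<comment> \<open>Bootstrapping: the derivative of \<open>g\<close> at \<open>y\<close> is
    \<open>G' (g y)\<close>, an expression in \<open>E'\<close> composed with \<open>g\<close>, so
    class \<open>k\<close> for \<open>g\<close> yields class \<open>k\<close> for its derivative.
    The start is the continuity of \<open>g\<close>.\<close>
  have Cg: "Ck_on k V g" for k
  proof (induction k)
    case 0
    then show ?case using UV by (simp add: homeomorphism_def)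
  next
    case (Suc k)
    have CE: "Ck_on k V (\<lambda>y. E' (g y) w)" for w
      using Ck_on_compose[OF Ck_on_subset[OF CE' \<open>D' \<subseteq> D\<close>] Suc.IH gD] .
    have "Ck_on k V (\<lambda>y. G' (g y) w)" for w
      unfolding G'_def
      by (intro Ck_on_add Ck_on_const Ck_on_scaleR Ck_on_mult Ck_on_diff Ck_on_inverse CE)
        (use gD in \<open>auto simp: D'_def\<close>)
    then show ?case
      unfolding Ck_on.simps using dg by (intro exI[of _ "\<lambda>y. G' (g y)"]) auto
  qed
  have CF: "Ck_on k U F" for k
    unfolding F_def using UV(2) \<open>D' \<subseteq> D\<close>
    by (intro Ck_on_add Ck_on_const Ck_on_scaleR Ck_on_diff Ck_on_subset[OF E]
        Ck_on_bounded_linear bounded_linear_inner_right bounded_linear_ident) auto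
  show ?thesis
  proof (rule that[of U V F g])
    show "n \<bullet> F v = E v - E p" for v
      by (simp add: F_def inner_add_right nn)
  qed (use UV CF Cg \<open>D' \<subseteq> D\<close> in auto)
qed

text \<open>Straightening turns the level set in \<open>U\<close> into part of the hyperplane
  orthogonal to \<open>n\<close>. Identifying this hyperplane linearly with the model space gives a
  single chart that serves at every point.\<close>

lemma smooth_submanifold_regular_level:
  fixes E :: "'a::euclidean_space \<Rightarrow> real"
  assumes D: "open D" "p \<in> D" and E: "\<And>k. Ck_on k D E"
    and n: "norm n = 1" "frechet_derivative E (at p) n \<noteq> 0"
    and dim: "DIM('a) = Suc DIM('b::euclidean_space)"
  shows "\<exists>V. open V \<and> p \<in> V \<and> smooth_submanifold TYPE('b) ({v \<in> D. E v = E p} \<inter> V)"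
proof -
  obtain U V F g where UV: "open U" "p \<in> U" "U \<subseteq> D" "open V" "homeomorphism U V F g"
    and CF: "\<And>k. Ck_on k U F" and Cg: "\<And>k. Ck_on k V g"
    and nF: "\<And>v. v \<in> U \<Longrightarrow> n \<bullet> F v = E v - E p"
    by (rule regular_level_straightening[OF D E n]) blast
  let ?M = "{v \<in> D. E v = E p} \<inter> U" and ?H = "{x. n \<bullet> x = 0}"
  have "n \<noteq> 0" using n by auto
  then have "dim (UNIV :: 'b set) = dim ?H"
    using dim by (simp add: dim_hyperplane)
  then obtain \<alpha> :: "'b \<Rightarrow> 'a" and \<beta> where lin: "linear \<alpha>" "linear \<beta>"
    and \<alpha>\<beta>: "range \<alpha> = ?H" "\<And>x. \<beta> (\<alpha> x) = x" "\<And>y. y \<in> ?H \<Longrightarrow> \<alpha> (\<beta> y) = y"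
    by (rule isometries_subspaces[OF subspace_UNIV subspace_hyperplane]) auto
  have bl: "bounded_linear \<alpha>" "bounded_linear \<beta>"
    using lin linear_conv_bounded_linear by blast+
  note hom = UV(5)[unfolded homeomorphism_def]
  let ?W = "\<alpha> -` V" and ?\<phi> = "\<lambda>x. g (\<alpha> x)" and ?\<psi> = "\<lambda>v. \<beta> (F v)"
  have FH: "F v \<in> ?H" if "v \<in> ?M" for v using that nF by simp
  have W: "open ?W"
    using UV(4) bl by (intro open_vimage) (auto intro: linear_continuous_on)
  have \<phi>: "smooth_on ?W ?\<phi>"
    using W by (intro smooth_on_open allI Ck_on_compose[OF Cg Ck_on_bounded_linear[OF bl(1)]]) auto
  have "smooth_on U ?\<psi>"
    using UV(1) by (intro smooth_on_open allI Ck_on_compose_bounded_linear[OF bl(2)] CF)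
  then have \<psi>: "smooth_on ?M ?\<psi>"
    by (rule smooth_on_subset) simp
  have "homeomorphism ?W ?M ?\<phi> ?\<psi>"
  proof
    show "?\<phi> ` ?W \<subseteq> ?M"
    proof safe
      fix x assume x: "\<alpha> x \<in> V"
      then have "g (\<alpha> x) \<in> U" "F (g (\<alpha> x)) = \<alpha> x" using hom by auto
      moreover have "n \<bullet> \<alpha> x = 0" using \<alpha>\<beta>(1) by auto
      ultimately show "g (\<alpha> x) \<in> U" "g (\<alpha> x) \<in> D" "E (g (\<alpha> x)) = E p"
        using nF[of "g (\<alpha> x)"] UV(3) by auto
    qed
    show "?\<psi> ` ?M \<subseteq> ?W" using FH \<alpha>\<beta>(3) hom by auto
    show "?\<psi> (?\<phi> x) = x" if "x \<in> ?W" for x using that hom \<alpha>\<beta>(2) by simp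
    show "?\<phi> (?\<psi> y) = y" if "y \<in> ?M" for y using that hom \<alpha>\<beta>(3) FH by simp
  qed (use \<phi> \<psi> smooth_on_imp_continuous_on in auto)
  then have "smooth_submanifold TYPE('b) ?M"
    unfolding smooth_submanifold_def using UV(1) W \<phi> \<psi>
    by (intro ballI exI[of _ U] exI[of _ ?W] exI[of _ ?\<phi>] exI[of _ ?\<psi>]) (auto simp: Int_assoc)
  with UV show ?thesis by blast
qed

text \<open>For the inclusion of the kernel, the straightening derivative sends a kernel vector to a
  vector orthogonal to \<open>n\<close>. The line through \<open>F p\<close> in that direction stays
  in the straightened level, and \<open>g\<close> bends it back to a curve in the level set.\<close>

lemma tangent_space_regular_level:
  fixes E :: "'a::euclidean_space \<Rightarrow> real"
  assumes D: "open D" "p \<in> D" and E: "\<And>k. Ck_on k D E"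
    and n: "norm n = 1" "frechet_derivative E (at p) n \<noteq> 0"
  shows "tangent_space (top_of_set {v \<in> D. E v = E p}) p = {w. frechet_derivative E (at p) w = 0}"
proof
  have dE: "(E has_derivative frechet_derivative E (at p)) (at p)"
    using E[of "Suc 0"] D unfolding Ck_on_Suc_frechet[OF D(1)] frechet_derivative_works by blast
  show "tangent_space (top_of_set {v \<in> D. E v = E p}) p \<subseteq> {w. frechet_derivative E (at p) w = 0}"
    by (rule tangent_space_subset_kernel[OF dE, where k = "E p"]) simp
  obtain U V F g where UV: "open U" "p \<in> U" "U \<subseteq> D" "open V" "homeomorphism U V F g"
    and CF: "\<And>k. Ck_on k U F" and Cg: "\<And>k. Ck_on k V g"
    and nF: "\<And>v. v \<in> U \<Longrightarrow> n \<bullet> F v = E v - E p"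
    by (rule regular_level_straightening[OF D E n]) blast
  note hom = UV(5)[unfolded homeomorphism_def]
  have FpV: "F p \<in> V" using hom UV(2) by blast
  obtain F' where dF: "(F has_derivative F') (at p)"
    using CF[of "Suc 0"] UV(2) by auto
  obtain g' where dg: "(g has_derivative g') (at (F p))"
    using Cg[of "Suc 0"] FpV by auto
  have "((\<lambda>v. g (F v)) has_derivative (\<lambda>w. g' (F' w))) (at p)"
    using has_derivative_compose[OF dF dg] .
  moreover have "((\<lambda>v. g (F v)) has_derivative (\<lambda>w. w)) (at p)"
    by (rule has_derivative_transform_within_open[of "\<lambda>v. v" _ p UNIV U]) (use UV(1,2) hom in auto)
  ultimately have "(\<lambda>w. g' (F' w)) = (\<lambda>w. w)"
    by (rule has_derivative_unique)
  then have gF': "g' (F' w) = w" for w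
    by (rule fun_cong)
  \<comment> \<open>Near \<open>p\<close> the coordinate of \<open>F\<close> along \<open>n\<close>
    is \<open>E\<close> up to a constant, so the kernel of \<open>E'\<close> goes to the hyperplane
    orthogonal to \<open>n\<close>.\<close>
  have "((\<lambda>v. n \<bullet> F v) has_derivative (\<lambda>w. n \<bullet> F' w)) (at p)"
    using dF by (rule has_derivative_inner_right)
  moreover have "((\<lambda>v. n \<bullet> F v) has_derivative frechet_derivative E (at p)) (at p)"
    by (rule has_derivative_transform_within_open[of "\<lambda>v. E v - E p" _ p UNIV U])
      (use UV(1,2) nF in \<open>auto intro!: derivative_eq_intros dE\<close>)
  ultimately have "(\<lambda>w. n \<bullet> F' w) = frechet_derivative E (at p)"
    by (rule has_derivative_unique)
  then have nF': "n \<bullet> F' w = frechet_derivative E (at p) w" for w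
    by (rule fun_cong)
  show "{w. frechet_derivative E (at p) w = 0} \<subseteq> tangent_space (top_of_set {v \<in> D. E v = E p}) p"
  proof safe
    fix w assume w: "frechet_derivative E (at p) w = 0"
    obtain e where e: "e > 0" "\<And>r. r \<in> {-e<..<e} \<Longrightarrow> F p + r *\<^sub>R F' w \<in> V"
      by (rule line_in_open[OF UV(4) FpV, of "F' w"]) blast
    let ?c = "\<lambda>r. g (F p + r *\<^sub>R F' w)"
    have c0: "?c 0 = p" using hom UV(2) by simp
    have sm: "smooth_on {-e<..<e} ?c"
      using Cg UV(4) e(2) by (intro smooth_on_affine_line[of V] smooth_on_open) auto
    have "?c r \<in> {v \<in> D. E v = E p}" if "r \<in> {-e<..<e}" for r
    proof -
      have "?c r \<in> U" "F (?c r) = F p + r *\<^sub>R F' w" using hom e(2)[OF that] by blast+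
      then have "E (?c r) - E p = n \<bullet> (F p + r *\<^sub>R F' w)" using nF[of "?c r"] by simp
      then show ?thesis
        using UV(2,3) \<open>?c r \<in> U\<close> nF[of p] nF'[of w] w by (auto simp: inner_add_right)
    qed
    then have "continuous_map (top_of_set {-e<..<e}) (top_of_set {v \<in> D. E v = E p}) ?c"
      using smooth_on_imp_continuous_on[OF sm] by auto
    moreover have "(?c has_vector_derivative w) (at 0)"
    proof -
      have "(?c has_derivative (\<lambda>r. g' (r *\<^sub>R F' w))) (at 0)"
        using dg by (intro has_derivative_compose[of "\<lambda>r. F p + r *\<^sub>R F' w" _ 0 UNIV g])
          (auto intro!: derivative_eq_intros)
      then show ?thesis
        using linear_cmul[OF has_derivative_linear[OF dg]]
        by (simp add: has_vector_derivative_def gF')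
    qed
    ultimately show "w \<in> tangent_space (top_of_set {v \<in> D. E v = E p}) p"
      unfolding tangent_space_def using e(1) sm c0
      by (intro CollectI exI[of _ e] conjI exI[of _ ?c]) simp_all
  qed
qed

section \<open>The energy of the four body problem\<close>

lemma open_phase_domain: "open (phase_domain m)"
proof -
  have "phase_domain m = (\<Inter>j. {v. v$1 \<noteq> prim_x m $ j} \<union> {v. v$3 \<noteq> prim_y m $ j})"
    by (auto simp: phase_domain_def)
  then show ?thesis
    by (auto intro!: open_INT open_Un open_Collect_neq continuous_intros)
qed

text \<open>Away from the primaries each squared distance \<open>q j\<close> is a positive
  polynomial, and each potential term is a multiple of its power with exponent -1/2.\<close>

lemma Ck_on_energy: "Ck_on k (phase_domain m) (energy m)"
proof -
  define q :: "3 \<Rightarrow> real^4 \<Rightarrow> real" where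
    "q j v = (v$1 - prim_x m $ j) * (v$1 - prim_x m $ j) + (v$3 - prim_y m $ j) * (v$3 - prim_y m $ j)" for j v
  have q_pos: "q j v > 0" if "v \<in> phase_domain m" for j v
    using that by (auto simp: phase_domain_def q_def sum_squares_gt_zero_iff)
  have nth: "Ck_on k (phase_domain m) (\<lambda>v. v $ i)" for i
    by (intro Ck_on_bounded_linear bounded_linear_vec_nth)
  have Cq: "Ck_on k (phase_domain m) (q j)" for j
    unfolding q_def by (intro Ck_on_add Ck_on_mult Ck_on_diff Ck_on_const nth)
  have "Ck_on k (phase_domain m) (\<lambda>v. q j v powr (-1/2))" for j
    using Ck_on_compose[OF Ck_on_powr Cq] q_pos by fast
  then have "Ck_on k (phase_domain m) (\<lambda>v. 1/2 * (v$2 * v$2 + v$4 * v$4) -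
      (1/2 * (v$1 * v$1 + v$3 * v$3) + (\<Sum>j\<in>UNIV. m$j * q j v powr (-1/2))))"
    by (intro Ck_on_add Ck_on_mult Ck_on_diff Ck_on_const Ck_on_sum nth)
  then show ?thesis
  proof (rule Ck_on_cong[OF open_phase_domain])
    fix v assume v: "v \<in> phase_domain m"
    have "m$j * q j v powr (-1/2) = m$j / dist_prim m j (v$1) (v$3)" for j
      using q_pos[OF v, of j] powr_minus_divide[of "q j v" "1/2"]
      by (simp add: powr_half_sqrt dist_prim_def q_def power2_eq_square)
    then show "1/2 * (v$2 * v$2 + v$4 * v$4) -
      (1/2 * (v$1 * v$1 + v$3 * v$3) + (\<Sum>j\<in>UNIV. m$j * q j v powr (-1/2))) = energy m v"
      by (simp add: energy_def Omega_def power2_eq_square)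
  qed
qed

lemma energy_has_derivative:
  assumes "v \<in> phase_domain m"
  shows "(energy m has_derivative frechet_derivative (energy m) (at v)) (at v)"
  using Ck_on_energy[of "Suc 0" m] assms
  unfolding Ck_on_Suc_frechet[OF open_phase_domain] frechet_derivative_works by blast

text \<open>The partial derivatives of the energy in positions are minus those of
  \<open>Omega\<close>, and in velocities they are the velocities. The potential terms then cancel,
  as do the two Coriolis terms with each other.\<close>

lemma frechet_derivative_energy_crfbp:
  assumes v: "v \<in> phase_domain m"
  shows "frechet_derivative (energy m) (at v) (crfbp m v) = 0"
proof -
  let ?E' = "frechet_derivative (energy m) (at v)"
  have lin: "linear ?E'"
    using energy_has_derivative[OF v] by (rule has_derivative_linear)
  \<comment> \<open>The coordinate line is parametrized by the coordinate itself, to match the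
    one-variable derivatives in \<open>crfbp\<close>.\<close>
  have partial: "((\<lambda>r. energy m (v + (r - v $ i) *\<^sub>R axis i 1)) has_real_derivative ?E' (axis i 1)) (at (v $ i))" for i
  proof -
    have "((\<lambda>r. v + (r - v $ i) *\<^sub>R axis i 1) has_derivative (\<lambda>r. r *\<^sub>R axis i 1)) (at (v $ i))"
      by (auto intro!: derivative_eq_intros)
    then have "((\<lambda>r. energy m (v + (r - v $ i) *\<^sub>R axis i 1)) has_derivative (\<lambda>r. ?E' (r *\<^sub>R axis i 1))) (at (v $ i))"
      by (rule has_derivative_compose) (use energy_has_derivative[OF v] in simp)
    then show ?thesis
      by (simp add: has_field_derivative_def linear_cmul[OF lin] mult_commute_abs)
  qed
  have ax: "axis (i::4) (1::real) $ j = (if j = i then 1 else 0)" for i j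
    by (simp add: axis_def)
  have neq: "(1::4) \<noteq> 2" "(1::4) \<noteq> 3" "(1::4) \<noteq> 4" "(2::4) \<noteq> 3" "(2::4) \<noteq> 4" "(3::4) \<noteq> 4"
    by simp_all
  \<comment> \<open>Subtracting the energy from the kinetic part isolates \<open>Omega\<close> as a
    function of the first position coordinate.\<close>
  have "((\<lambda>r. 1/2 * ((v$2)^2 + (v$4)^2) - energy m (v + (r - v $ 1) *\<^sub>R axis 1 1)) has_real_derivative
      - ?E' (axis 1 1)) (at (v $ 1))"
    by (rule derivative_eq_intros partial refl | simp)+
  then have d1: "deriv (\<lambda>x. Omega m x (v$3)) (v$1) = - ?E' (axis 1 1)"
    by (intro DERIV_imp_deriv) (simp add: energy_def ax neq neq[symmetric])
  have "((\<lambda>r. 1/2 * ((v$2)^2 + (v$4)^2) - energy m (v + (r - v $ 3) *\<^sub>R axis 3 1)) has_real_derivative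
      - ?E' (axis 3 1)) (at (v $ 3))"
    by (rule derivative_eq_intros partial refl | simp)+
  then have d3: "deriv (\<lambda>y. Omega m (v$1) y) (v$3) = - ?E' (axis 3 1)"
    by (intro DERIV_imp_deriv) (simp add: energy_def ax neq neq[symmetric])
  have "((\<lambda>r. energy m (v + (r - v $ 2) *\<^sub>R axis 2 1)) has_real_derivative v $ 2) (at (v $ 2))"
    unfolding energy_def
    by (auto simp: ax neq neq[symmetric] intro!: derivative_eq_intros)
  with partial[of 2] have d2: "?E' (axis 2 1) = v $ 2" by (rule DERIV_unique)
  have "((\<lambda>r. energy m (v + (r - v $ 4) *\<^sub>R axis 4 1)) has_real_derivative v $ 4) (at (v $ 4))"
    unfolding energy_def
    by (auto simp: ax neq neq[symmetric] intro!: derivative_eq_intros)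
  with partial[of 4] have d4: "?E' (axis 4 1) = v $ 4" by (rule DERIV_unique)
  have exp: "crfbp m v = (\<Sum>i\<in>UNIV. crfbp m v $ i *\<^sub>R axis i 1)"
    using basis_expansion[of "crfbp m v"] by (simp add: scalar_mult_eq_scaleR)
  have "?E' (crfbp m v) = (\<Sum>i\<in>UNIV. crfbp m v $ i * ?E' (axis i 1))"
    by (subst exp) (simp add: linear_sum[OF lin] linear_cmul[OF lin])
  also have "\<dots> = 0"
    by (simp add: sum_4 crfbp_def d1 d2 d3 d4 algebra_simps)
  finally show ?thesis .
qed

section \<open>Conservation of energy and the invariant manifolds\<close>

lemma energy_integral_curve:
  assumes c: "integral_curve m c (closed_segment 0 t)"
  shows "energy m (c t) = energy m (c 0)"
proof -
  \<comment> \<open>The segment is convex for either sign of \<open>t\<close>, so a vanishing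
    derivative within it forces constancy.\<close>
  have "\<exists>k. \<forall>r\<in>closed_segment 0 t. energy m (c r) = k"
  proof (rule has_derivative_zero_constant)
    fix r assume "r \<in> closed_segment 0 t"
    then have r: "c r \<in> phase_domain m"
      "(c has_derivative (\<lambda>h. h *\<^sub>R crfbp m (c r))) (at r within closed_segment 0 t)"
      using c by (auto simp: integral_curve_def has_vector_derivative_def)
    have "((\<lambda>r. energy m (c r)) has_derivative
        (\<lambda>h. frechet_derivative (energy m) (at (c r)) (h *\<^sub>R crfbp m (c r)))) (at r within closed_segment 0 t)"
      using r(2) energy_has_derivative[OF r(1)] by (rule has_derivative_compose)
    then show "((\<lambda>r. energy m (c r)) has_derivative (\<lambda>h. 0)) (at r within closed_segment 0 t)"
      using linear_cmul[OF has_derivative_linear[OF energy_has_derivative[OF r(1)]]]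
      by (simp add: frechet_derivative_energy_crfbp[OF r(1)])
  qed simp
  then show ?thesis by auto
qed

text \<open>Whatever point the choice in \<open>flow\<close> selects is the end of some integral
  curve from \<open>p\<close>, and every such curve conserves energy.\<close>

lemma energy_flow:
  assumes "(p, t) \<in> flow_domain m"
  shows "energy m (flow m p t) = energy m p"
proof -
  have "\<exists>q c. integral_curve m c (closed_segment 0 t) \<and> c 0 = p \<and> c t = q"
    using assms by (auto simp: flow_domain_def)
  then have "\<exists>c. integral_curve m c (closed_segment 0 t) \<and> c 0 = p \<and> c t = flow m p t"
    unfolding flow_def by (rule someI_ex)
  then obtain c where "integral_curve m c (closed_segment 0 t)" "c 0 = p" "c t = flow m p t"
    by blast
  then show ?thesis using energy_integral_curve[of m c t] by simp
qed

lemma flow_domain_imp_phase_domain: "(p, t) \<in> flow_domain m \<Longrightarrow> p \<in> phase_domain m"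
  by (auto simp: flow_domain_def integral_curve_def)

text \<open>Along the orbit the energy is constant, and by continuity it tends to the energy of
  \<open>x0\<close>. The filter is \<open>at_top\<close> for the stable and \<open>at_bot\<close>
  for the unstable manifold.\<close>

lemma energy_eq_limit:
  assumes x0: "x0 \<in> phase_domain m" and lim: "(flow m p \<longlongrightarrow> x0) F"
    and F: "\<forall>\<^sub>F t in F. (p, t) \<in> flow_domain m" "F \<noteq> bot"
  shows "energy m p = energy m x0"
proof -
  have "isCont (energy m) x0"
    using energy_has_derivative[OF x0] by (rule has_derivative_continuous)
  then have "((\<lambda>t. energy m (flow m p t)) \<longlongrightarrow> energy m x0) F"
    using lim by (rule isCont_tendsto_compose)
  then have "((\<lambda>t. energy m p) \<longlongrightarrow> energy m x0) F"
    by (rule Lim_transform_eventually) (use F(1) in \<open>eventually_elim, simp add: energy_flow\<close>)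
  then show ?thesis using F(2) by (simp add: tendsto_const_iff)
qed

lemma stable_manifold_subset_energy_level:
  assumes "x0 \<in> phase_domain m"
  shows "stable_manifold m x0 \<subseteq> energy_level m x0"
proof
  fix p assume p: "p \<in> stable_manifold m x0"
  then have "\<forall>\<^sub>F t in at_top. (p, t) \<in> flow_domain m"
    using eventually_mono[OF eventually_ge_at_top[of "0::real"]] by (simp add: stable_manifold_def)
  with p show "p \<in> energy_level m x0"
    using energy_eq_limit[OF assms, of p at_top] flow_domain_imp_phase_domain[of p 0 m]
    by (auto simp: stable_manifold_def energy_level_def)
qed

lemma unstable_manifold_subset_energy_level:
  assumes "x0 \<in> phase_domain m"
  shows "unstable_manifold m x0 \<subseteq> energy_level m x0"
proof
  fix p assume p: "p \<in> unstable_manifold m x0"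
  then have "\<forall>\<^sub>F t in at_bot. (p, t) \<in> flow_domain m"
    using eventually_mono[OF eventually_le_at_bot[of "0::real"]] by (simp add: unstable_manifold_def)
  with p show "p \<in> energy_level m x0"
    using energy_eq_limit[OF assms, of p at_bot] flow_domain_imp_phase_domain[of p 0 m]
    by (auto simp: unstable_manifold_def energy_level_def)
qed

section \<open>Comparing the two parametrizations through \<open>G_map\<close>\<close>

lemma energy_level_eqI:
  assumes "energy m v = energy m w" "v$1 = w$1" "v$2 = w$2" "v$3 = w$3" "sgn (v$4) = sgn (w$4)"
  shows "v = w"
proof -
  \<comment> \<open>With the other coordinates equal, the energy fixes the last one up to
    sign.\<close>
  have "(v$4)^2 = (w$4)^2" using assms by (simp add: energy_def)
  then have "\<bar>v$4\<bar> = \<bar>w$4\<bar>" by (simp add: power2_eq_iff abs_eq_iff)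
  then have "v$4 = w$4" using assms(5) by (auto simp: sgn_if abs_if split: if_splits)
  with assms show ?thesis by (simp add: vec_eq_iff forall_4)
qed

text \<open>\<open>G_map\<close> is a difference in 4-space followed by the linear projection to the
  first three coordinates; the conditional on \<open>i\<close> embeds the three indices into
  four.\<close>

lemma has_derivative_G_map:
  assumes u: "(\<Gamma>u has_derivative \<Gamma>u') (at (w$1, w$2))" and s: "(\<Gamma>s has_derivative \<Gamma>s') (at (w$3, 0))"
  shows "(G_map \<Gamma>u \<Gamma>s has_derivative
    (\<lambda>h. \<chi> i. (\<Gamma>u' (h$1, h$2) - \<Gamma>s' (h$3, 0)) $ (if i = 1 then 1 else if i = 2 then 2 else 3))) (at w)"
proof -
  let ?k = "\<lambda>i::3. if i = 1 then 1 else if i = 2 then 2 else (3::4)"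
  have G: "G_map \<Gamma>u \<Gamma>s = (\<lambda>w. \<chi> i. (\<Gamma>u (w$1, w$2) - \<Gamma>s (w$3, 0)) $ ?k i)"
    by (rule ext) (simp add: G_map_def vec_eq_iff forall_3)
  have "((\<lambda>w. \<Gamma>u (w$1, w$2)) has_derivative (\<lambda>h. \<Gamma>u' (h$1, h$2))) (at w)"
    by (rule has_derivative_compose[where f = "\<lambda>w. (w$1, w$2)", OF _ u])
      (intro has_derivative_Pair has_derivative_const bounded_linear_imp_has_derivative
        bounded_linear_vec_nth)
  moreover have "((\<lambda>w. \<Gamma>s (w$3, 0)) has_derivative (\<lambda>h. \<Gamma>s' (h$3, 0))) (at w)"
    by (rule has_derivative_compose[where f = "\<lambda>w. (w$3, 0)", OF _ s])
      (intro has_derivative_Pair has_derivative_const bounded_linear_imp_has_derivative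
        bounded_linear_vec_nth)
  ultimately have "((\<lambda>w. \<Gamma>u (w$1, w$2) - \<Gamma>s (w$3, 0)) has_derivative (\<lambda>h. \<Gamma>u' (h$1, h$2) - \<Gamma>s' (h$3, 0))) (at w)"
    by (rule has_derivative_diff)
  then show ?thesis
    unfolding G by (intro bounded_linear.has_derivative[where f = "\<lambda>x. \<chi> i. x $ ?k i"])
      (auto intro!: linear_conv_bounded_linear[THEN iffD1] linearI simp: vec_eq_iff)
qed

section \<open>Transversality\<close>

theorem lemma1p4:
  fixes m :: "real^3" and x0 xh :: "real^4"
    and \<Gamma>u \<Gamma>s :: "real \<times> real \<Rightarrow> real^4"
    and sh th \<sigma>h :: real
  assumes masses: "0 < m$3" "m$3 \<le> m$2" "m$2 \<le> m$1" "m$1 < 1" "m$1 + m$2 + m$3 = 1"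
    and saddle: "saddle_focus m x0"
    and smooth: "smooth_on unit_square \<Gamma>u" "smooth_on unit_square \<Gamma>s"
    and dom: "\<Gamma>u ` unit_square \<subseteq> phase_domain m" "\<Gamma>s ` unit_square \<subseteq> phase_domain m"
    and Wu: "\<Gamma>u ` unit_square \<subseteq> unstable_manifold m x0"
    and Ws: "\<Gamma>s ` unit_square \<subseteq> stable_manifold m x0"
    and aligned: "well_aligned m \<Gamma>s" "well_aligned m \<Gamma>u"
    and params: "sh \<in> {-1<..<1}" "th \<in> {-1<..<1}" "\<sigma>h \<in> {-1<..<1}"
    and zero: "G_map \<Gamma>u \<Gamma>s (vector [sh, th, \<sigma>h]) = 0"
    and sign: "sgn (\<Gamma>u (sh, th) $ 4) = sgn (\<Gamma>s (\<sigma>h, 0) $ 4)"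
    and xh: "xh = \<Gamma>u (sh, th)"
    and nonsing: "invertible (jacobian (G_map \<Gamma>u \<Gamma>s) (at (vector [sh, th, \<sigma>h])))"
    and grad: "gradient (energy m) xh \<noteq> 0"
  shows "xh = \<Gamma>s (\<sigma>h, 0) \<and> homoclinic m x0 xh
    \<and> (\<exists>V. open V \<and> xh \<in> V \<and> smooth_submanifold TYPE(real^3) (energy_level m x0 \<inter> V))
    \<and> set_sum (tangent_space (top_of_set (unstable_manifold m x0)) xh)
              (tangent_space (top_of_set (stable_manifold m x0)) xh)
        = tangent_space (top_of_set (energy_level m x0)) xh
    \<and> (\<forall>Tu Ts.
         immersed_submanifold TYPE(real^2) Tu \<and> topspace Tu = unstable_manifold m x0 \<and>
         continuous_map (top_of_set unit_square) Tu \<Gamma>u \<and>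
         immersed_submanifold TYPE(real^2) Ts \<and> topspace Ts = stable_manifold m x0 \<and>
         continuous_map (top_of_set unit_square) Ts \<Gamma>s
         \<longrightarrow> set_sum (tangent_space Tu xh) (tangent_space Ts xh)
             = tangent_space (top_of_set (energy_level m x0)) xh)"
proof -
  let ?E = "energy m" and ?L = "energy_level m x0"
  let ?E' = "frechet_derivative ?E (at xh)"
  let ?u' = "frechet_derivative \<Gamma>u (at (sh, th))" and ?s' = "frechet_derivative \<Gamma>s (at (\<sigma>h, 0))"
  let ?w = "vector [sh, th, \<sigma>h] :: real^3"
  have x0: "x0 \<in> phase_domain m" using saddle by (simp add: saddle_focus_def)
  note WuL = unstable_manifold_subset_energy_level[OF x0]
    and WsL = stable_manifold_subset_energy_level[OF x0]
  have int: "(sh, th) \<in> interior unit_square" "(\<sigma>h, 0) \<in> interior unit_square"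
    using params by (auto simp: interior_Times)
  then have sq: "(sh, th) \<in> unit_square" "(\<sigma>h, 0) \<in> unit_square"
    using interior_subset by blast+
  have xh_u: "xh \<in> unstable_manifold m x0" using Wu sq xh by auto
  have s_s: "\<Gamma>s (\<sigma>h, 0) \<in> stable_manifold m x0" using Ws sq by auto
  have xh_s: "xh = \<Gamma>s (\<sigma>h, 0)"
  proof (rule energy_level_eqI)
    show "?E xh = ?E (\<Gamma>s (\<sigma>h, 0))"
      using subsetD[OF WuL xh_u] subsetD[OF WsL s_s] by (simp add: energy_level_def)
  qed (use zero sign xh in \<open>auto simp: G_map_def vec_eq_iff forall_3\<close>)
  have hom: "homoclinic m x0 xh"
    using xh_u s_s xh_s by (simp add: homoclinic_def)
  have xhD: "xh \<in> phase_domain m" and EL: "?L = {v \<in> phase_domain m. ?E v = ?E xh}"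
    using subsetD[OF WuL xh_u] by (auto simp: energy_level_def)
  have lin: "linear ?E'"
    using energy_has_derivative[OF xhD] by (rule has_derivative_linear)
  \<comment> \<open>A coordinate vector along which the gradient does not vanish.\<close>
  obtain n where n: "norm n = 1" "?E' n \<noteq> 0"
    using grad by (auto simp: gradient_def vec_eq_iff intro: that[OF norm_axis_1])
  note level = open_phase_domain xhD Ck_on_energy n
  have submanifold: "\<exists>V. open V \<and> xh \<in> V \<and> smooth_submanifold TYPE(real^3) (?L \<inter> V)"
    unfolding EL by (rule smooth_submanifold_regular_level[OF level]) simp
  have TL: "tangent_space (top_of_set ?L) xh = {v. ?E' v = 0}"
    unfolding EL by (rule tangent_space_regular_level[OF level])
  have du: "(\<Gamma>u has_derivative ?u') (at (sh, th))" and ds: "(\<Gamma>s has_derivative ?s') (at (\<sigma>h, 0))"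
    using smooth_on_imp_differentiable smooth int frechet_derivative_works by blast+
  note lin_us = has_derivative_linear[OF du] has_derivative_linear[OF ds]
  \<comment> \<open>The derivative of \<open>G_map\<close> before projection: since projecting
    \<open>L\<close> gives an invertible matrix, \<open>L\<close> is injective.\<close>
  define L where "L h = ?u' (h$1, h$2) - ?s' (h$3, 0)" for h :: "real^3"
  have L: "linear L"
  proof (rule linearI)
    fix h k :: "real^3" and r :: real
    have "(h$1 + k$1, h$2 + k$2) = (h$1, h$2) + (k$1, k$2)" "(h$3 + k$3, 0) = (h$3, 0) + (k$3, 0::real)"
      "(r * h$1, r * h$2) = r *\<^sub>R (h$1, h$2)" "(r * h$3, 0) = r *\<^sub>R (h$3, 0::real)"
      by simp_all
    then show "L (h + k) = L h + L k" "L (r *\<^sub>R h) = r *\<^sub>R L h"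
      by (simp_all only: L_def vector_add_component vector_scaleR_component real_scaleR_def
          linear_add[OF lin_us(1)] linear_add[OF lin_us(2)] linear_cmul[OF lin_us(1)] linear_cmul[OF lin_us(2)])
        (simp_all add: algebra_simps)
  qed
  have "inj L"
  proof (rule linear_injective_0[THEN iffD2, OF L], intro allI impI)
    fix h assume "L h = 0"
    have dG: "(G_map \<Gamma>u \<Gamma>s has_derivative (\<lambda>h. \<chi> i. L h $ (if i = 1 then 1 else if i = 2 then 2 else 3))) (at ?w)"
      unfolding L_def using du ds by (intro has_derivative_G_map) simp_all
    have "jacobian (G_map \<Gamma>u \<Gamma>s) (at ?w) *v h = (\<chi> i. L h $ (if i = 1 then 1 else if i = 2 then 2 else 3))"
      by (rule fun_cong[OF has_derivative_unique[OF jacobian_works[THEN iffD1, OF differentiableI[OF dG]] dG]])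
    also have "\<dots> = 0" using \<open>L h = 0\<close> by (simp add: vec_eq_iff)
    finally show "h = 0"
      using nonsing unfolding invertible_def using matrix_left_invertible_ker by blast
  qed
  have kernel: "tangent_space T xh \<subseteq> {v. ?E' v = 0}" if "topspace T \<subseteq> ?L" for T
    by (rule tangent_space_subset_kernel[OF energy_has_derivative[OF xhD], where k = "?E x0"])
      (use that in \<open>auto simp: energy_level_def\<close>)
  \<comment> \<open>General topologies \<open>Tu\<close> and \<open>Ts\<close> allow one argument
    for both the subspace topologies and the immersed ones.\<close>
  have transversal: "set_sum (tangent_space Tu xh) (tangent_space Ts xh) = {v. ?E' v = 0}"
    if Tu: "topspace Tu = unstable_manifold m x0" "continuous_map (top_of_set unit_square) Tu \<Gamma>u"
      and Ts: "topspace Ts = stable_manifold m x0" "continuous_map (top_of_set unit_square) Ts \<Gamma>s"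
    for Tu Ts
  proof (rule set_sum_eq_kernel[OF lin n(2) L \<open>inj L\<close>])
    show "tangent_space Tu xh \<subseteq> {v. ?E' v = 0}" "tangent_space Ts xh \<subseteq> {v. ?E' v = 0}"
      using kernel Tu(1) Ts(1) WuL WsL by simp_all
    have "L h \<in> set_sum (tangent_space Tu xh) (tangent_space Ts xh)" for h
    proof -
      have "?u' (h$1, h$2) \<in> tangent_space Tu xh"
        unfolding xh by (rule frechet_derivative_in_tangent_space[OF smooth(1) int(1) Tu(2)])
      \<comment> \<open>The minus sign in \<open>L\<close> is absorbed by reversing the direction in
        the parameter square.\<close>
      moreover have "?s' (- (h$3, 0)) \<in> tangent_space Ts xh"
        unfolding xh_s by (rule frechet_derivative_in_tangent_space[OF smooth(2) int(2) Ts(2)])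
      moreover have "L h = ?u' (h$1, h$2) + ?s' (- (h$3, 0))"
        by (simp only: L_def linear_neg[OF lin_us(2)]) simp
      ultimately show ?thesis unfolding set_sum_def by blast
    qed
    then show "range L \<subseteq> set_sum (tangent_space Tu xh) (tangent_space Ts xh)" by blast
  qed simp
  have "continuous_map (top_of_set unit_square) (top_of_set (unstable_manifold m x0)) \<Gamma>u"
    "continuous_map (top_of_set unit_square) (top_of_set (stable_manifold m x0)) \<Gamma>s"
    using smooth_on_imp_continuous_on[OF smooth(1)] smooth_on_imp_continuous_on[OF smooth(2)] Wu Ws
    by auto
  then have "set_sum (tangent_space (top_of_set (unstable_manifold m x0)) xh)
      (tangent_space (top_of_set (stable_manifold m x0)) xh) = {v. ?E' v = 0}"
    by (intro transversal) simp_all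
  then show ?thesis
    using xh_s hom submanifold TL transversal by (intro conjI allI impI) simp_all
qed

end
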